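(* Let $g:[0,\infty)\to\mathbb{R}$ be a non-negative, increasing, concave function, and let $A,B$ be $n\times n$ complex positive semidefinite matrices such that $A\ge \|B\|_\infty\,\mathbf{I}$. Then $\lambda_k^\downarrow(g(A-B)) \ge \lambda_k^\downarrow(g(A)-g(B))$ for all $k=1,\dots,n$.
   Context: For Hermitian matrices, $X\ge Y$ means $X-Y$ is positive semidefinite. $\mathbf{I}$ is the identity matrix and $\|B\|_\infty$ is the operator (spectral) norm. For a Hermitian matrix $X$, $g(X)$ is defined by the spectral functional calculus, and $\lambda_1^\downarrow(X)\ge\lambda_2^\downarrow(X)\ge\cdots\ge\lambda_n^\downarrow(X)$ are the eigenvalues of $X$, counted with multiplicity, in non-increasing order. *)

theory Defs
  imports
    "HOL-Analysis.Convex"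
    "Jordan_Normal_Form.Schur_Decomposition"
begin

definition hermitian :: "complex mat \<Rightarrow> bool" where
  "hermitian A \<longleftrightarrow> square_mat A \<and> mat_adjoint A = A"

definition pos_semidef :: "complex mat \<Rightarrow> bool" where
  "pos_semidef A \<longleftrightarrow>
     hermitian A \<and> (\<forall>v \<in> carrier_vec (dim_row A). 0 \<le> Re ((A *\<^sub>v v) \<bullet>c v))"

definition loewner_le :: "complex mat \<Rightarrow> complex mat \<Rightarrow> bool" where
  "loewner_le Y X \<longleftrightarrow> pos_semidef (X - Y)"

definition vec_l2norm :: "complex vec \<Rightarrow> real" where
  "vec_l2norm v = sqrt (Re (v \<bullet>c v))"

definition spectral_norm :: "complex mat \<Rightarrow> real" where
  "spectral_norm B =
     (SUP v \<in> {v \<in> carrier_vec (dim_col B). vec_l2norm v \<le> 1}. vec_l2norm (B *\<^sub>v v))"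

definition unitary :: "complex mat \<Rightarrow> bool" where
  "unitary U \<longleftrightarrow> square_mat U \<and> mat_adjoint U * U = 1\<^sub>m (dim_row U)"

abbreviation real_diag :: "nat \<Rightarrow> (nat \<Rightarrow> real) \<Rightarrow> complex mat" where
  "real_diag n d \<equiv> mat_diag n (\<lambda>i. complex_of_real (d i))"

definition spectral_decomp :: "complex mat \<Rightarrow> complex mat \<Rightarrow> (nat \<Rightarrow> real) \<Rightarrow> bool" where
  "spectral_decomp X U d \<longleftrightarrow>
     unitary U \<and> dim_row U = dim_row X \<and> X = U * real_diag (dim_row X) d * mat_adjoint U"

text \<open>
  Spectral functional calculus. Every Hermitian matrix has a spectral decomposition, and the
  result does not depend on the one chosen (lemma \<open>mat_fun_eq\<close>). The value is unspecified on
  matrices that are not Hermitian.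
\<close>

definition mat_fun :: "(real \<Rightarrow> real) \<Rightarrow> complex mat \<Rightarrow> complex mat" where
  "mat_fun g X = (THE Y. \<exists>U d. spectral_decomp X U d \<and>
     Y = U * real_diag (dim_row X) (g \<circ> d) * mat_adjoint U)"

text \<open>
  Eigenvalues in non-increasing order, repeated according to multiplicity as roots of the
  characteristic polynomial, with indices starting from 1. Meant for Hermitian matrices only,
  where the roots are real and \<open>Re\<close> is just the change of type.
\<close>

definition eigval_desc :: "complex mat \<Rightarrow> nat \<Rightarrow> real" where
  "eigval_desc X k =
     rev (sorted_list_of_multiset (image_mset Re (proots (char_poly X)))) ! (k - 1)"

lemma mat_adjoint_carrier:
  assumes "U \<in> carrier_mat n n" shows "mat_adjoint U \<in> carrier_mat n n"
  using assms unfolding mat_adjoint_def by auto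

lemma real_diag_intertwine:
  assumes W: "W \<in> carrier_mat n n" and eq: "real_diag n d * W = W * real_diag n e"
  shows "real_diag n (g \<circ> d) * W = W * real_diag n (g \<circ> e)"
proof -
  have "W $$ (i, j) = 0 \<or> d i = e j" if "i < n" "j < n" for i j
    using arg_cong[OF eq, of "\<lambda>M. M $$ (i, j)"] that
    by (simp add: mat_diag_mult_left[OF W] mat_diag_mult_right[OF W] mult.commute)
  thus ?thesis
    unfolding mat_diag_mult_left[OF W] mat_diag_mult_right[OF W] by (intro eq_matI) (auto, metis)
qed

lemma spectral_decomp_unique:
  assumes U: "spectral_decomp X U d" and V: "spectral_decomp X V e"
  shows "U * real_diag (dim_row X) (g \<circ> d) * mat_adjoint U =
         V * real_diag (dim_row X) (g \<circ> e) * mat_adjoint V"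
proof -
  define n where "n = dim_row X"
  let ?U = "mat_adjoint U" and ?V = "mat_adjoint V"
  let ?D = "real_diag n d" and ?E = "real_diag n e"
  let ?gD = "real_diag n (g \<circ> d)" and ?gE = "real_diag n (g \<circ> e)"
  have Uc: "U \<in> carrier_mat n n" and Vc: "V \<in> carrier_mat n n"
    using U V unfolding spectral_decomp_def unitary_def n_def by auto
  note c = Uc Vc mat_adjoint_carrier[OF Uc] mat_adjoint_carrier[OF Vc] mat_diag_dim
  have U1: "?U * U = 1\<^sub>m n" and V1: "?V * V = 1\<^sub>m n"
    using U V Uc Vc unfolding spectral_decomp_def unitary_def n_def by auto
  have U2: "U * ?U = 1\<^sub>m n" and V2: "V * ?V = 1\<^sub>m n"
    using mat_mult_left_right_inverse U1 V1 c by blast+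
  have X: "U * ?D * ?U = V * ?E * ?V"
    using U V unfolding spectral_decomp_def n_def by simp
  define W where "W = ?U * V"
  have Wc: "W \<in> carrier_mat n n" unfolding W_def using c by auto
  have UW: "U * W = V"
    unfolding W_def using U2 c by (simp flip: assoc_mult_mat[of U n n ?U n V n])
  have WV: "W * ?V = ?U"
    unfolding W_def using V2 c by (simp add: assoc_mult_mat[of ?U n n V n ?V n])
  have "?D * W = ?U * (U * ?D * ?U) * V"
  proof -
    have "?U * (U * ?D * ?U) = ?U * (U * (?D * ?U))"
      using c by (simp add: assoc_mult_mat[of U n n ?D n ?U n])
    also have "\<dots> = (?U * U) * (?D * ?U)"
      using c by (intro assoc_mult_mat[symmetric, of _ n n _ n _ n] mult_carrier_mat[of _ n n]) auto
    also have "\<dots> = ?D * ?U" unfolding U1 using c by (intro left_mult_one_mat[of _ n n] mult_carrier_mat[of _ n n]) auto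
    finally show ?thesis
      unfolding W_def using c by (simp add: assoc_mult_mat[of ?D n n ?U n V n])
  qed
  also have "\<dots> = ?U * (V * ?E * ?V) * V" unfolding X ..
  also have "\<dots> = ?U * (V * ?E * ?V * V)"
    using c by (intro assoc_mult_mat[of _ n n _ n _ n] mult_carrier_mat[of _ n n]) auto
  also have "V * ?E * ?V * V = V * ?E * (?V * V)"
    using c by (intro assoc_mult_mat[of _ n n _ n _ n] mult_carrier_mat[of _ n n]) auto
  also have "V * ?E * (?V * V) = V * ?E"
    unfolding V1 using c by (intro right_mult_one_mat[of _ n n] mult_carrier_mat[of _ n n]) auto
  also have "?U * (V * ?E) = W * ?E"
    unfolding W_def using c by (simp add: assoc_mult_mat[of ?U n n V n ?E n])
  finally have "?gD * W = W * ?gE" by (rule real_diag_intertwine[OF Wc])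
  hence "U * (?gD * W) * ?V = U * (W * ?gE) * ?V" by simp
  moreover have "U * (?gD * W) * ?V = U * ?gD * ?U"
  proof -
    have "U * (?gD * W) * ?V = U * ?gD * W * ?V"
      using c Wc by (subst assoc_mult_mat[of U n n ?gD n W n]) auto
    also have "\<dots> = U * ?gD * (W * ?V)"
      using c Wc by (intro assoc_mult_mat[of _ n n _ n _ n] mult_carrier_mat[of _ n n]) auto
    finally show ?thesis unfolding WV .
  qed
  moreover have "U * (W * ?gE) * ?V = V * ?gE * ?V"
    using c Wc by (subst assoc_mult_mat[of U n n W n ?gE n, symmetric]) (auto simp: UW)
  ultimately show ?thesis unfolding n_def by simp
qed

lemma mat_fun_eq:
  assumes "spectral_decomp X U d"
  shows "mat_fun g X = U * real_diag (dim_row X) (g \<circ> d) * mat_adjoint U"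
  unfolding mat_fun_def using assms spectral_decomp_unique by (intro the_equality) blast+

end

theory Submission
  imports Defs
begin

text \<open>
  By a dimension count there is a unit vector \<open>x\<close> lying both in the span of eigenvectors of
  \<open>g(A) - g(B)\<close> for its \<open>k\<close> largest eigenvalues and in the span of eigenvectors of \<open>A - B\<close>
  for eigenvalues \<open>d\<close> with \<open>g(d) \<le> \<lambda>\<^sub>k(g(A - B))\<close>. Let \<open>t\<close> be the largest such \<open>d\<close>, and put
  \<open>\<alpha> = \<langle>Ax, x\<rangle>\<close>, \<open>\<beta> = \<langle>Bx, x\<rangle>\<close>, \<open>b = \<parallel>B\<parallel>\<close>, so that \<open>\<beta> \<le> b \<le> \<alpha> \<le> t + \<beta>\<close>. Jensen gives
  \<open>\<langle>g(A)x, x\<rangle> \<le> g(\<alpha>) \<le> g(t + \<beta>)\<close>. Since \<open>g\<close> lies above its chord on \<open>[0, b]\<close>,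
  \<open>\<langle>g(B)x, x\<rangle> \<ge> g(0) + \<beta> (g(b) - g(0)) / b\<close>, and as \<open>0 \<le> t\<close> and \<open>b \<le> t + \<beta>\<close>, the slope of
  \<open>g\<close> over \<open>[t, t + \<beta>]\<close> is at most its slope over \<open>[0, b]\<close>. Hence
  \<open>\<lambda>\<^sub>k(g(A) - g(B)) \<le> \<langle>(g(A) - g(B))x, x\<rangle> \<le> g(t) \<le> \<lambda>\<^sub>k(g(A - B))\<close>.
\<close>

subsection \<open>Adjoints and quadratic forms\<close>

lemma mat_adjoint_dim [simp]:
  "dim_row (mat_adjoint A) = dim_col A" "dim_col (mat_adjoint A) = dim_row A"
  unfolding mat_adjoint_def by auto

lemma mat_adjoint_index [simp]:
  fixes A :: "complex mat"
  assumes "i < dim_col A" "j < dim_row A"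
  shows "mat_adjoint A $$ (i, j) = cnj (A $$ (j, i))"
  using assms unfolding mat_adjoint_def by (simp add: mat_of_rows_def)

lemma mat_adjoint_adjoint [simp]: "mat_adjoint (mat_adjoint A) = (A :: complex mat)"
  by (rule eq_matI) auto

lemma mat_adjoint_mult:
  fixes A B :: "complex mat"
  assumes "A \<in> carrier_mat m n" "B \<in> carrier_mat n r"
  shows "mat_adjoint (A * B) = mat_adjoint B * mat_adjoint A"
  using assms by (intro eq_matI) (auto simp: scalar_prod_def ac_simps)

lemma mat_adjoint_minus:
  fixes A B :: "complex mat"
  assumes "A \<in> carrier_mat m n" "B \<in> carrier_mat m n"
  shows "mat_adjoint (A - B) = mat_adjoint A - mat_adjoint B"
  using assms by (intro eq_matI) auto

lemma mat_adjoint_real_diag [simp]: "mat_adjoint (real_diag n f) = real_diag n f"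
  by (intro eq_matI) (auto simp: mat_diag_def)

lemma cscalar_prod_sum:
  "(v :: complex vec) \<bullet>c w = (\<Sum>i<dim_vec w. v $ i * cnj (w $ i))"
  by (simp add: scalar_prod_def lessThan_atLeast0)

lemma cscalar_prod_commute:
  fixes v w :: "complex vec"
  assumes "v \<in> carrier_vec n" "w \<in> carrier_vec n"
  shows "w \<bullet>c v = cnj (v \<bullet>c w)"
  using assms by (simp add: cscalar_prod_sum ac_simps)

lemma cscalar_prod_self:
  "(v :: complex vec) \<bullet>c v = complex_of_real (\<Sum>i<dim_vec v. (cmod (v $ i))\<^sup>2)"
  by (simp only: cscalar_prod_sum complex_norm_square of_real_sum)

lemma cscalar_prod_adjoint:
  fixes A :: "complex mat"
  assumes A: "A \<in> carrier_mat m n" and x: "x \<in> carrier_vec n" and y: "y \<in> carrier_vec m"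
  shows "(A *\<^sub>v x) \<bullet>c y = x \<bullet>c (mat_adjoint A *\<^sub>v y)"
proof -
  have "(A *\<^sub>v x) \<bullet>c y = (\<Sum>i<m. \<Sum>j<n. A $$ (i, j) * x $ j * cnj (y $ i))"
    using assms by (auto simp: cscalar_prod_sum scalar_prod_def lessThan_atLeast0 sum_distrib_right)
  also have "\<dots> = (\<Sum>j<n. \<Sum>i<m. A $$ (i, j) * x $ j * cnj (y $ i))"
    by (rule sum.swap)
  also have "\<dots> = x \<bullet>c (mat_adjoint A *\<^sub>v y)"
    using assms by (auto simp: cscalar_prod_sum scalar_prod_def lessThan_atLeast0 sum_distrib_left ac_simps)
  finally show ?thesis .
qed

text \<open>For unitary \<open>U\<close> and a unit vector \<open>x\<close> these are the squared
  moduli of the coordinates of \<open>x\<close> in the basis of columns, hence a probability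
  distribution. Quadratic forms thereby become expectations, to which scalar Jensen-type
  inequalities apply.\<close>

definition spectral_weight :: "complex mat \<Rightarrow> complex vec \<Rightarrow> nat \<Rightarrow> real" where
  "spectral_weight U x i = (cmod (x \<bullet>c col U i))\<^sup>2"

lemma adjoint_mult_vec_index:
  fixes U :: "complex mat"
  assumes "U \<in> carrier_mat n m" "x \<in> carrier_vec n" "i < m"
  shows "(mat_adjoint U *\<^sub>v x) $ i = x \<bullet>c col U i"
  using assms by (auto simp: cscalar_prod_sum scalar_prod_def lessThan_atLeast0 intro!: sum.cong)

lemma real_diag_mult_vec_index:
  assumes "y \<in> carrier_vec n" "i < n"
  shows "(real_diag n f *\<^sub>v y) $ i = complex_of_real (f i) * y $ i"
proof -
  have "(real_diag n f *\<^sub>v y) $ i = (\<Sum>j<n. (if i = j then complex_of_real (f j) else 0) * y $ j)"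
    using assms by (auto simp: mat_diag_def scalar_prod_def lessThan_atLeast0)
  also have "\<dots> = (\<Sum>j<n. if i = j then complex_of_real (f j) * y $ j else 0)"
    by (intro sum.cong) auto
  finally show ?thesis using assms by simp
qed

text \<open>In the coordinates \<open>mat_adjoint U *\<^sub>v x\<close> the form is diagonal. Taking
  \<open>f\<close> to be \<open>1\<close>, the eigenvalues, or \<open>g\<close> of the eigenvalues
  yields the norm, the form of the matrix, and the form of its image under \<open>g\<close>, all
  with the same weights.\<close>

lemma spectral_quadratic_form:
  fixes U :: "complex mat"
  assumes U: "U \<in> carrier_mat n n" and x: "x \<in> carrier_vec n"
  shows "((U * real_diag n f * mat_adjoint U) *\<^sub>v x) \<bullet>c x =
         complex_of_real (\<Sum>i<n. f i * spectral_weight U x i)"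
proof -
  let ?y = "mat_adjoint U *\<^sub>v x"
  have U': "mat_adjoint U \<in> carrier_mat n n" using U by (rule mat_adjoint_carrier)
  have y: "?y \<in> carrier_vec n" using U' x by auto
  have D: "real_diag n f \<in> carrier_mat n n" by simp
  have "(U * real_diag n f * mat_adjoint U) *\<^sub>v x = (U * real_diag n f) *\<^sub>v ?y"
    by (rule assoc_mult_mat_vec[OF mult_carrier_mat[OF U D] U' x])
  also have "\<dots> = U *\<^sub>v (real_diag n f *\<^sub>v ?y)"
    by (rule assoc_mult_mat_vec[OF U D y])
  finally have "(U * real_diag n f * mat_adjoint U) *\<^sub>v x = U *\<^sub>v (real_diag n f *\<^sub>v ?y)" .
  hence "((U * real_diag n f * mat_adjoint U) *\<^sub>v x) \<bullet>c x = (real_diag n f *\<^sub>v ?y) \<bullet>c ?y"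
    using cscalar_prod_adjoint[OF U _ x, of "real_diag n f *\<^sub>v ?y"] y D by auto
  also have "\<dots> = (\<Sum>i<n. complex_of_real (f i) * (?y $ i * cnj (?y $ i)))"
  proof -
    have "(real_diag n f *\<^sub>v ?y) $ i = complex_of_real (f i) * ?y $ i" if "i < n" for i
      using real_diag_mult_vec_index[OF y that] .
    thus ?thesis using U' y unfolding cscalar_prod_sum by (auto simp: ac_simps simp del: index_mult_mat_vec)
  qed
  also have "\<dots> = (\<Sum>i<n. complex_of_real (f i * spectral_weight U x i))"
  proof (intro sum.cong refl)
    fix i assume "i \<in> {..<n}"
    hence "?y $ i = x \<bullet>c col U i" using adjoint_mult_vec_index[OF U x] by simp
    thus "complex_of_real (f i) * (?y $ i * cnj (?y $ i)) = complex_of_real (f i * spectral_weight U x i)"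
      by (simp only: spectral_weight_def of_real_mult complex_norm_square)
  qed
  finally show ?thesis by simp
qed

lemma unitary_carrierD:
  assumes "unitary U" "U \<in> carrier_mat n n"
  shows "mat_adjoint U * U = 1\<^sub>m n" "U * mat_adjoint U = 1\<^sub>m n"
proof -
  show "mat_adjoint U * U = 1\<^sub>m n" using assms by (auto simp: unitary_def)
  thus "U * mat_adjoint U = 1\<^sub>m n"
    using assms mat_mult_left_right_inverse mat_adjoint_carrier by blast
qed

text \<open>Parseval's identity: the diagonal form with \<open>f = 1\<close> is the identity
  matrix.\<close>

lemma sum_spectral_weight:
  assumes "unitary U" and U: "U \<in> carrier_mat n n" and x: "x \<in> carrier_vec n"
  shows "x \<bullet>c x = complex_of_real (\<Sum>i<n. spectral_weight U x i)"
proof -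
  have "U * real_diag n (\<lambda>_. 1) * mat_adjoint U = 1\<^sub>m n"
    using unitary_carrierD[OF assms(1) U] U by simp
  thus ?thesis using spectral_quadratic_form[OF U x, of "\<lambda>_. 1"] x by simp
qed

subsection \<open>The spectral theorem for Hermitian matrices\<close>

text \<open>Orthogonality to \<open>vs\<close> is a homogeneous linear system with fewer equations
  than unknowns. Padding it with zero rows makes it square, so that a vanishing determinant supplies
  the solution.\<close>

lemma exists_orthogonal_vec:
  assumes vs: "set vs \<subseteq> carrier_vec n" and len: "length vs < n"
  shows "\<exists>x :: complex vec. x \<in> carrier_vec n \<and> x \<noteq> 0\<^sub>v n \<and> (\<forall>v \<in> set vs. x \<bullet>c v = 0)"
proof -
  define M where "M = mat n n (\<lambda>(i, j). if i < length vs then cnj (vs ! i $ j) else 0)"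
  have M: "M \<in> carrier_mat n n" unfolding M_def by simp
  \<comment> \<open>Row \<open>length vs\<close> of \<open>M\<close> is the first padding row, so
    the transpose annihilates the corresponding unit vector and is singular.\<close>
  have "transpose_mat M *\<^sub>v unit_vec n (length vs) = 0\<^sub>v n"
    using len by (intro eq_vecI) (auto simp: M_def)
  moreover have "unit_vec n (length vs) \<noteq> (0\<^sub>v n :: complex vec)" using len by simp
  ultimately have "det (transpose_mat M) = 0"
    using M det_0_iff_vec_prod_zero[of "transpose_mat M" n]
    by (metis transpose_carrier_mat unit_vec_carrier)
  hence "det M = 0" using det_transpose[OF M] by simp
  then obtain x where x: "x \<in> carrier_vec n" "x \<noteq> 0\<^sub>v n" "M *\<^sub>v x = 0\<^sub>v n"
    using det_0_iff_vec_prod_zero[OF M] by auto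
  have "x \<bullet>c (vs ! i) = 0" if "i < length vs" for i
  proof -
    have "vs ! i \<in> carrier_vec n" using that vs by auto
    moreover have "(M *\<^sub>v x) $ i = 0" using x that len by simp
    ultimately show ?thesis using that x(1) len
      by (simp add: M_def cscalar_prod_sum scalar_prod_def lessThan_atLeast0 ac_simps)
  qed
  thus ?thesis using x by (intro exI[of _ x]) (auto simp: in_set_conv_nth)
qed

lemma exists_unit_multiple:
  fixes x :: "complex vec"
  assumes x: "x \<in> carrier_vec n" "x \<noteq> 0\<^sub>v n"
  shows "\<exists>c. (c \<cdot>\<^sub>v x) \<bullet>c (c \<cdot>\<^sub>v x) = 1"
proof -
  define s where "s = (\<Sum>i<n. (cmod (x $ i))\<^sup>2)"
  have xx: "x \<bullet>c x = complex_of_real s" using x(1) by (simp add: cscalar_prod_self s_def)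
  have "s \<noteq> 0" using x xx conjugate_square_eq_0_vec[OF x(1)] by auto
  moreover have "s \<ge> 0" unfolding s_def by (intro sum_nonneg) auto
  ultimately have "1 / sqrt s * (1 / sqrt s) * s = 1" by (simp add: real_sqrt_mult_self)
  hence "complex_of_real (1 / sqrt s) * complex_of_real (1 / sqrt s) * (x \<bullet>c x) = 1"
    unfolding xx by (simp only: of_real_mult[symmetric] of_real_1)
  thus ?thesis using x(1)
    by (intro exI[of _ "complex_of_real (1 / sqrt s)"]) (simp add: conjugate_smult_vec ac_simps)
qed

lemma exists_unit_orthogonal_vec:
  assumes "set vs \<subseteq> carrier_vec n" "length vs < n"
  shows "\<exists>x :: complex vec. x \<in> carrier_vec n \<and> x \<bullet>c x = 1 \<and> (\<forall>v \<in> set vs. x \<bullet>c v = 0)"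
proof -
  obtain x :: "complex vec" where x: "x \<in> carrier_vec n" "x \<noteq> 0\<^sub>v n" "\<forall>v \<in> set vs. x \<bullet>c v = 0"
    using exists_orthogonal_vec[OF assms] by blast
  obtain c where "(c \<cdot>\<^sub>v x) \<bullet>c (c \<cdot>\<^sub>v x) = 1" using exists_unit_multiple[OF x(1,2)] by blast
  moreover have "(c \<cdot>\<^sub>v x) \<bullet>c v = 0" if "v \<in> set vs" for v
    using that x assms(1) by (subst scalar_prod_smult_left) auto
  ultimately show ?thesis using x(1) by (intro exI[of _ "c \<cdot>\<^sub>v x"]) auto
qed

text \<open>Only the values at indices below \<open>m\<close> are constrained, so a system can be
  enlarged by updating the function at \<open>m\<close>.\<close>

definition orthonormal :: "nat \<Rightarrow> nat \<Rightarrow> (nat \<Rightarrow> complex vec) \<Rightarrow> bool" where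
  "orthonormal n m u \<longleftrightarrow> (\<forall>i<m. u i \<in> carrier_vec n) \<and>
     (\<forall>i<m. \<forall>j<m. u i \<bullet>c u j = (if i = j then 1 else 0))"

lemma orthonormal_Suc:
  assumes u: "orthonormal n m u" and v: "v \<in> carrier_vec n" "v \<bullet>c v = 1"
    and orth: "\<And>i. i < m \<Longrightarrow> v \<bullet>c u i = 0"
  shows "orthonormal n (Suc m) (u(m := v))"
proof -
  have "u i \<bullet>c v = 0" if "i < m" for i
    using cscalar_prod_commute[OF v(1), of "u i"] orth[OF that] u that by (simp add: orthonormal_def)
  thus ?thesis using u v orth unfolding orthonormal_def by (auto simp: less_Suc_eq)
qed

text \<open>Induction on the number \<open>n - m\<close> of missing vectors: as long as it is
  positive, some unit vector is orthogonal to all those present.\<close>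

lemma orthonormal_extend:
  assumes "m \<le> n" "orthonormal n m u"
  shows "\<exists>u'. orthonormal n n u' \<and> (\<forall>i<m. u' i = u i)"
  using assms
proof (induction "n - m" arbitrary: m u)
  case 0
  thus ?case by auto
next
  case (Suc k)
  hence "set (map u [0..<m]) \<subseteq> carrier_vec n" by (auto simp: orthonormal_def)
  moreover have "length (map u [0..<m]) < n" using Suc by simp
  ultimately obtain v where "v \<in> carrier_vec n" "v \<bullet>c v = 1" "\<forall>w \<in> set (map u [0..<m]). v \<bullet>c w = 0"
    using exists_unit_orthogonal_vec by blast
  hence "orthonormal n (Suc m) (u(m := v))" using Suc.prems by (intro orthonormal_Suc) auto
  moreover have "k = n - Suc m" "Suc m \<le> n" using Suc by auto
  ultimately obtain u' where "orthonormal n n u'" "\<forall>i<Suc m. u' i = (u(m := v)) i"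
    using Suc.hyps(1) by blast
  thus ?case by (intro exI[of _ u']) auto
qed

lemma orthonormal_unitary:
  assumes u: "orthonormal n n u"
  shows "unitary (mat n n (\<lambda>(i, j). u j $ i))"
proof -
  have "mat_adjoint (mat n n (\<lambda>(i, j). u j $ i)) * mat n n (\<lambda>(i, j). u j $ i) = 1\<^sub>m n"
  proof (intro eq_matI)
    fix i j assume "i < dim_row (1\<^sub>m n :: complex mat)" "j < dim_col (1\<^sub>m n :: complex mat)"
    hence ij: "i < n" "j < n" by auto
    moreover have "u i \<in> carrier_vec n" "u j \<in> carrier_vec n" using u ij by (auto simp: orthonormal_def)
    ultimately have "(mat_adjoint (mat n n (\<lambda>(i, j). u j $ i)) * mat n n (\<lambda>(i, j). u j $ i)) $$ (i, j) = u j \<bullet>c u i"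
      by (auto simp: scalar_prod_def cscalar_prod_sum lessThan_atLeast0 ac_simps intro!: sum.cong)
    thus "(mat_adjoint (mat n n (\<lambda>(i, j). u j $ i)) * mat n n (\<lambda>(i, j). u j $ i)) $$ (i, j) = 1\<^sub>m n $$ (i, j)"
      using u ij by (simp add: orthonormal_def)
  qed auto
  thus ?thesis by (simp add: unitary_def)
qed

text \<open>Over the complex numbers the characteristic polynomial splits into \<open>n\<close>
  linear factors, and \<open>n > 0\<close> provides at least one root.\<close>

lemma exists_eigenvector:
  fixes Y :: "complex mat"
  assumes Y: "Y \<in> carrier_mat n n" and n: "n > 0"
  shows "\<exists>y e. y \<in> carrier_vec n \<and> y \<noteq> 0\<^sub>v n \<and> Y *\<^sub>v y = e \<cdot>\<^sub>v y"
proof -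
  obtain as where as: "char_poly Y = (\<Prod>a\<leftarrow>as. [:- a, 1:])" "length as = n"
    using char_poly_factorized[OF Y] by auto
  then obtain a as' where "as = a # as'" using n by (cases as) auto
  hence "poly (char_poly Y) a = 0" using as by simp
  hence "eigenvalue Y a" using eigenvalue_root_char_poly[OF Y] by simp
  thus ?thesis using Y unfolding eigenvalue_def eigenvector_def by auto
qed

lemma hermitian_cscalar_prod:
  assumes "hermitian X" "X \<in> carrier_mat n n" "x \<in> carrier_vec n" "y \<in> carrier_vec n"
  shows "(X *\<^sub>v x) \<bullet>c y = x \<bullet>c (X *\<^sub>v y)"
  using cscalar_prod_adjoint[OF assms(2-4)] assms(1) by (simp add: hermitian_def)

text \<open>Compressing \<open>X\<close> to the orthogonal complement of eigenvectors already found yields a further one.\<close>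

lemma hermitian_eigenvector_orthogonal:
  assumes X: "X \<in> carrier_mat n n" and herm: "hermitian X" and mn: "m < n" and u: "orthonormal n m u"
    and eig: "\<And>i. i < m \<Longrightarrow> X *\<^sub>v u i = complex_of_real (d i) \<cdot>\<^sub>v u i"
  shows "\<exists>v e. v \<in> carrier_vec n \<and> v \<bullet>c v = 1 \<and> (\<forall>i<m. v \<bullet>c u i = 0) \<and>
           X *\<^sub>v v = complex_of_real e \<cdot>\<^sub>v v"
proof -
  obtain u' where u': "orthonormal n n u'" "\<forall>i<m. u' i = u i"
    using orthonormal_extend[OF less_imp_le[OF mn] u] by blast
  define U where "U = mat n n (\<lambda>(i, j). u' j $ i)"
  have U: "U \<in> carrier_mat n n" unfolding U_def by simp
  have colU: "col U i = u' i" if "i < n" for i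
    using that u'(1) unfolding U_def by (intro eq_vecI) (auto simp: orthonormal_def)
  have UU: "mat_adjoint U * U = 1\<^sub>m n" "U * mat_adjoint U = 1\<^sub>m n"
    using unitary_carrierD[OF _ U] orthonormal_unitary[OF u'(1)] unfolding U_def by auto
  have U': "mat_adjoint U \<in> carrier_mat n n" using U by (rule mat_adjoint_carrier)
  \<comment> \<open>\<open>H\<close> represents \<open>X\<close> in an orthonormal basis whose first
    \<open>m\<close> members are the given eigenvectors.\<close>
  define H where "H = mat_adjoint U * X * U"
  have H: "H \<in> carrier_mat n n" unfolding H_def using U U' X by auto
  have Hadj: "mat_adjoint H = H"
    unfolding H_def using U U' X herm
    by (simp add: mat_adjoint_mult[of _ n n _ n] mult_carrier_mat[of _ n n _ n] hermitian_def
        assoc_mult_mat[of _ n n _ n _ n])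
  \<comment> \<open>The given eigenvectors make the lower left block of \<open>H\<close> vanish.
    Self-adjointness carries this over to the upper right block, which is the one that matters when
    \<open>H\<close> acts on the zero-padded vector \<open>z\<close>.\<close>
  have H0: "H $$ (i, j) = 0" if "i < m" "m \<le> j" "j < n" for i j
  proof -
    have "H = mat_adjoint U * (X * U)" unfolding H_def by (rule assoc_mult_mat[OF U' X U])
    hence "col H i = mat_adjoint U *\<^sub>v col (X * U) i"
      using that mn U X U' by (simp add: col_mult2[of _ n n _ n])
    also have "col (X * U) i = X *\<^sub>v u i"
      using that mn U X colU u'(2) by (simp add: col_mult2[of _ n n _ n] mult_mat_vec_def)
    also have "\<dots> = complex_of_real (d i) \<cdot>\<^sub>v u i" using eig that by simp
    finally have "H $$ (j, i) = (mat_adjoint U *\<^sub>v (complex_of_real (d i) \<cdot>\<^sub>v u i)) $ j"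
      using that mn H by (metis carrier_matD index_col less_trans)
    also have "\<dots> = (complex_of_real (d i) \<cdot>\<^sub>v u i) \<bullet>c col U j"
      using that u by (intro adjoint_mult_vec_index[OF U]) (auto simp: orthonormal_def)
    also have "\<dots> = complex_of_real (d i) * (u' i \<bullet>c u' j)"
    proof -
      have "u' i \<in> carrier_vec n" "u' j \<in> carrier_vec n"
        using that u'(1) mn by (auto simp: orthonormal_def)
      hence "dim_vec (u i) = n" "dim_vec (u' j) = n" using that u'(2) by auto
      thus ?thesis using that colU u'(2) by (subst scalar_prod_smult_left) auto
    qed
    also have "u' i \<bullet>c u' j = 0" using that u'(1) mn by (auto simp: orthonormal_def)
    finally have "mat_adjoint H $$ (i, j) = 0" using that mn H by simp
    thus ?thesis unfolding Hadj .
  qed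
  \<comment> \<open>The lower right block is the compression to the orthogonal complement. It has
    positive size because \<open>m < n\<close>, so it has an eigenvector.\<close>
  define Y where "Y = mat (n - m) (n - m) (\<lambda>(i, j). H $$ (m + i, m + j))"
  have "Y \<in> carrier_mat (n - m) (n - m)" unfolding Y_def by simp
  then obtain y e where y: "y \<in> carrier_vec (n - m)" "y \<noteq> 0\<^sub>v (n - m)" "Y *\<^sub>v y = e \<cdot>\<^sub>v y"
    using exists_eigenvector[of Y "n - m"] mn by auto
  define z where "z = vec n (\<lambda>i. if i < m then 0 else y $ (i - m))"
  have z: "z \<in> carrier_vec n" unfolding z_def by simp
  have Hz: "H *\<^sub>v z = e \<cdot>\<^sub>v z"
  proof (intro eq_vecI)
    fix i assume "i < dim_vec (e \<cdot>\<^sub>v z)"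
    hence i: "i < n" using z by simp
    have split: "{..<n} = {..<m} \<union> (\<lambda>j. m + j) ` {..<n - m}"
    proof -
      have "j \<in> (\<lambda>j. m + j) ` {..<n - m}" if "j < n" "\<not> j < m" for j
        using that by (intro image_eqI[of _ _ "j - m"]) auto
      thus ?thesis using mn by auto
    qed
    have "(H *\<^sub>v z) $ i = (\<Sum>j<n. H $$ (i, j) * z $ j)"
      using i H z by (auto simp: scalar_prod_def lessThan_atLeast0)
    also have "\<dots> = (\<Sum>j<m. H $$ (i, j) * z $ j) + (\<Sum>j\<in>(\<lambda>j. m + j) ` {..<n - m}. H $$ (i, j) * z $ j)"
      unfolding split by (rule sum.union_disjoint) auto
    also have "(\<Sum>j<m. H $$ (i, j) * z $ j) = 0"
      using mn by (intro sum.neutral) (auto simp: z_def)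
    also have "(\<Sum>j\<in>(\<lambda>j. m + j) ` {..<n - m}. H $$ (i, j) * z $ j) =
        (\<Sum>j<n - m. H $$ (i, m + j) * y $ j)"
      by (subst sum.reindex) (auto simp: z_def)
    also have "\<dots> = e * z $ i"
    proof (cases "i < m")
      case True
      thus ?thesis using i H0 by (auto simp: z_def intro!: sum.neutral)
    next
      case False
      hence "(Y *\<^sub>v y) $ (i - m) = (\<Sum>j<n - m. H $$ (i, m + j) * y $ j)"
        using i y(1) by (auto simp: Y_def scalar_prod_def lessThan_atLeast0)
      thus ?thesis using False i y by (simp add: z_def)
    qed
    finally show "(H *\<^sub>v z) $ i = (e \<cdot>\<^sub>v z) $ i" using i z by simp
  qed (use H z in auto)
  \<comment> \<open>Returning to the original basis turns the eigenvector \<open>z\<close> of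
    \<open>H\<close> into one of \<open>X\<close>.\<close>
  define w where "w = U *\<^sub>v z"
  have w: "w \<in> carrier_vec n" unfolding w_def using U z by auto
  have Uw: "mat_adjoint U *\<^sub>v w = z"
    unfolding w_def using UU(1) z by (simp flip: assoc_mult_mat_vec[OF U' U z])
  have "w \<noteq> 0\<^sub>v n"
  proof
    assume "w = 0\<^sub>v n"
    moreover have "mat_adjoint U *\<^sub>v 0\<^sub>v n = 0\<^sub>v n"
      using U by (intro eq_vecI) (auto simp: scalar_prod_def)
    ultimately have "z = 0\<^sub>v n" using Uw by simp
    have "y = 0\<^sub>v (n - m)"
    proof (intro eq_vecI)
      fix i assume "i < dim_vec (0\<^sub>v (n - m) :: complex vec)"
      hence i: "i < n - m" by simp
      hence "z $ (m + i) = 0" using \<open>z = 0\<^sub>v n\<close> by simp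
      thus "y $ i = 0\<^sub>v (n - m) $ i" using i by (simp add: z_def)
    qed (use y in auto)
    thus False using y(2) by simp
  qed
  have Xw: "X *\<^sub>v w = e \<cdot>\<^sub>v w"
  proof -
    have "X *\<^sub>v w = U *\<^sub>v (mat_adjoint U *\<^sub>v (X *\<^sub>v w))"
      using UU(2) X w by (simp flip: assoc_mult_mat_vec[OF U U'])
    also have "mat_adjoint U *\<^sub>v (X *\<^sub>v w) = H *\<^sub>v z"
      unfolding H_def w_def using U U' X z
      by (simp add: assoc_mult_mat_vec[of _ n n _ n] mult_carrier_mat[of _ n n _ n])
    also have "U *\<^sub>v (H *\<^sub>v z) = e \<cdot>\<^sub>v w"
      unfolding Hz w_def by (rule mult_mat_vec[OF U z])
    finally show ?thesis .
  qed
  \<comment> \<open>The eigenvalue is real: moving \<open>X\<close> across the inner product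
    replaces \<open>e\<close> by its conjugate, and \<open>w\<close> is nonzero.\<close>
  have "e * (w \<bullet>c w) = (X *\<^sub>v w) \<bullet>c w" unfolding Xw using w by simp
  also have "\<dots> = w \<bullet>c (X *\<^sub>v w)" by (rule hermitian_cscalar_prod[OF herm X w w])
  also have "\<dots> = cnj e * (w \<bullet>c w)" unfolding Xw using w by (simp add: conjugate_smult_vec)
  finally have "e = cnj e" using \<open>w \<noteq> 0\<^sub>v n\<close> w by simp
  hence e: "e = complex_of_real (Re e)" by (metis Reals_cnj_iff complex_is_Real_iff of_real_Re)
  obtain c where c: "(c \<cdot>\<^sub>v w) \<bullet>c (c \<cdot>\<^sub>v w) = 1" using exists_unit_multiple[OF w \<open>w \<noteq> 0\<^sub>v n\<close>] by blast
  have "(c \<cdot>\<^sub>v w) \<bullet>c u i = 0" if "i < m" for i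
  proof -
    \<comment> \<open>The coordinates of \<open>w\<close> along the old eigenvectors are the padding
      zeros of \<open>z\<close>.\<close>
    have "w \<bullet>c u i = z $ i"
      using adjoint_mult_vec_index[OF U w, of i] Uw colU[of i] u'(2) that mn by simp
    thus ?thesis using that mn w u by (simp add: z_def orthonormal_def)
  qed
  moreover have "X *\<^sub>v (c \<cdot>\<^sub>v w) = complex_of_real (Re e) \<cdot>\<^sub>v (c \<cdot>\<^sub>v w)"
    using mult_mat_vec[OF X w] Xw e by (simp add: smult_smult_assoc mult.commute)
  ultimately show ?thesis using c w by (intro exI[of _ "c \<cdot>\<^sub>v w"] exI[of _ "Re e"]) auto
qed

text \<open>Orthonormal eigenvectors are collected one at a time. Once there are \<open>n\<close>,
  they form the columns of a unitary \<open>U\<close>, and the eigenvector equations read column by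
  column \<open>X * U = U * real_diag n d\<close>.\<close>

lemma hermitian_spectral_decomp:
  assumes X: "X \<in> carrier_mat n n" and herm: "hermitian X"
  shows "\<exists>U d. spectral_decomp X U d"
proof -
  have "\<exists>u d. orthonormal n m u \<and> (\<forall>i<m. X *\<^sub>v u i = complex_of_real (d i) \<cdot>\<^sub>v u i)" if "m \<le> n" for m
    using that
  proof (induction m)
    case 0
    thus ?case by (auto simp: orthonormal_def)
  next
    case (Suc m)
    then obtain u d where u: "orthonormal n m u" "\<forall>i<m. X *\<^sub>v u i = complex_of_real (d i) \<cdot>\<^sub>v u i"
      by auto
    obtain v e where "v \<in> carrier_vec n" "v \<bullet>c v = 1" "\<forall>i<m. v \<bullet>c u i = 0"
        "X *\<^sub>v v = complex_of_real e \<cdot>\<^sub>v v"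
      using hermitian_eigenvector_orthogonal[OF X herm _ u(1), of d] Suc.prems u(2) by auto
    hence "orthonormal n (Suc m) (u(m := v))"
      "\<forall>i<Suc m. X *\<^sub>v (u(m := v)) i = complex_of_real ((d(m := e)) i) \<cdot>\<^sub>v (u(m := v)) i"
      using u orthonormal_Suc[OF u(1), of v] by (auto simp: less_Suc_eq)
    thus ?case by blast
  qed
  then obtain u d where u: "orthonormal n n u" "\<forall>i<n. X *\<^sub>v u i = complex_of_real (d i) \<cdot>\<^sub>v u i"
    by blast
  define U where "U = mat n n (\<lambda>(i, j). u j $ i)"
  have U: "U \<in> carrier_mat n n" unfolding U_def by simp
  have U': "mat_adjoint U \<in> carrier_mat n n" using U by (rule mat_adjoint_carrier)
  have uni: "unitary U" unfolding U_def by (rule orthonormal_unitary[OF u(1)])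
  have colU: "col U i = u i" if "i < n" for i
    using that u(1) unfolding U_def by (intro eq_vecI) (auto simp: orthonormal_def)
  have "X * U = U * real_diag n d"
  proof (intro mat_col_eqI)
    fix i assume "i < dim_col (U * real_diag n d)"
    hence i: "i < n" by (simp add: mat_diag_def)
    have "col (X * U) i = complex_of_real (d i) \<cdot>\<^sub>v u i"
      using i u(2) colU by (simp only: col_mult2[OF X U i])
    also have "\<dots> = col (U * real_diag n d) i"
      using i U unfolding colU[OF i, symmetric] by (intro eq_vecI) (auto simp: mat_diag_mult_right[OF U])
    finally show "col (X * U) i = col (U * real_diag n d) i" .
  qed (use X U in \<open>auto simp: mat_diag_def\<close>)
  hence "U * real_diag n d * mat_adjoint U = X * U * mat_adjoint U" by simp
  also have "\<dots> = X * (U * mat_adjoint U)" by (rule assoc_mult_mat[OF X U U'])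
  also have "\<dots> = X" using unitary_carrierD(2)[OF uni U] X by simp
  finally show ?thesis using uni U X unfolding spectral_decomp_def by (intro exI[of _ U] exI[of _ d]) auto
qed

subsection \<open>Eigenvalues\<close>

lemma spectral_decompD:
  assumes "X \<in> carrier_mat n n" "spectral_decomp X U d"
  shows "U \<in> carrier_mat n n" "unitary U" "X = U * real_diag n d * mat_adjoint U"
  using assms by (auto simp: spectral_decomp_def unitary_def)

lemma spectral_decompI:
  assumes "U \<in> carrier_mat n n" "unitary U"
  shows "spectral_decomp (U * real_diag n d * mat_adjoint U) U d"
  using assms by (simp add: spectral_decomp_def)

lemma cscalar_prod_spectral_decomp:
  assumes "X \<in> carrier_mat n n" "spectral_decomp X U d" "x \<in> carrier_vec n"
  shows "(X *\<^sub>v x) \<bullet>c x = complex_of_real (\<Sum>i<n. d i * spectral_weight U x i)"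
  using spectral_decompD[OF assms(1,2)] spectral_quadratic_form assms(3) by metis

lemma hermitian_unitary_conj_real_diag:
  assumes U: "U \<in> carrier_mat n n"
  shows "hermitian (U * real_diag n f * mat_adjoint U)"
proof -
  have U': "mat_adjoint U \<in> carrier_mat n n" using U by (rule mat_adjoint_carrier)
  have D: "real_diag n f \<in> carrier_mat n n" by simp
  have UD: "U * real_diag n f \<in> carrier_mat n n" using U by simp
  have "mat_adjoint (U * real_diag n f * mat_adjoint U) = U * (real_diag n f * mat_adjoint U)"
    by (simp add: mat_adjoint_mult[OF UD U'] mat_adjoint_mult[OF U D])
  thus ?thesis using assoc_mult_mat[OF U D U'] U by (simp add: hermitian_def)
qed

lemma hermitian_minus:
  assumes "hermitian A" "hermitian B" "A \<in> carrier_mat n n" "B \<in> carrier_mat n n"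
  shows "hermitian (A - B)"
  using assms by (simp add: hermitian_def mat_adjoint_minus[of _ n n])

lemma spectral_decomp_eigenvector:
  assumes X: "X \<in> carrier_mat n n" and dec: "spectral_decomp X U d" and i: "i < n"
  shows "col U i \<in> carrier_vec n" "col U i \<bullet>c col U i = 1"
    "X *\<^sub>v col U i = complex_of_real (d i) \<cdot>\<^sub>v col U i"
proof -
  note U = spectral_decompD[OF X dec]
  have U': "mat_adjoint U \<in> carrier_mat n n" using U(1) by (rule mat_adjoint_carrier)
  have UD: "U * real_diag n d \<in> carrier_mat n n" using U by simp
  note UU = unitary_carrierD[OF U(2,1)]
  show c: "col U i \<in> carrier_vec n" using U(1) i by auto
  have "col U i \<bullet>c col U i = (mat_adjoint U *\<^sub>v col U i) $ i"
    using adjoint_mult_vec_index[OF U(1) c i] by simp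
  also have "mat_adjoint U *\<^sub>v col U i = col (mat_adjoint U * U) i"
    using col_mult2[OF U' U(1) i] by simp
  also have "\<dots> $ i = 1" unfolding UU(1) using i by simp
  finally show "col U i \<bullet>c col U i = 1" .
  have "X * U = U * real_diag n d * mat_adjoint U * U" using U(3) by simp
  also have "\<dots> = U * real_diag n d * (mat_adjoint U * U)" by (rule assoc_mult_mat[OF UD U' U(1)])
  also have "\<dots> = U * real_diag n d" unfolding UU(1) by (rule right_mult_one_mat[OF UD])
  finally have "X *\<^sub>v col U i = col (U * real_diag n d) i" using col_mult2[OF X U(1) i] by simp
  also have "\<dots> = complex_of_real (d i) \<cdot>\<^sub>v col U i"
    using i U(1) by (intro eq_vecI) (auto simp: mat_diag_mult_right[OF U(1)])
  finally show "X *\<^sub>v col U i = complex_of_real (d i) \<cdot>\<^sub>v col U i" .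
qed

text \<open>An eigenvalue is the value of the quadratic form at its unit eigenvector.\<close>

lemma pos_semidef_eigenvalue_nonneg:
  assumes X: "X \<in> carrier_mat n n" and "spectral_decomp X U d" "pos_semidef X" "i < n"
  shows "0 \<le> d i"
proof -
  note e = spectral_decomp_eigenvector[OF X assms(2,4)]
  have "0 \<le> Re ((X *\<^sub>v col U i) \<bullet>c col U i)" using assms(3) e(1) X by (auto simp: pos_semidef_def)
  also have "(X *\<^sub>v col U i) \<bullet>c col U i = complex_of_real (d i)"
    unfolding e(3) using e(1,2) by simp
  finally show ?thesis by simp
qed

section \<open>The spectral norm as a bound on eigenvalues\<close>

lemma vec_l2norm_eq: "vec_l2norm v = sqrt (\<Sum>i<dim_vec v. (cmod (v $ i))\<^sup>2)"
  by (simp add: vec_l2norm_def cscalar_prod_self del: of_real_sum)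

text \<open>A crude bound, independent of \<open>v\<close>: every coordinate of \<open>v\<close> has
  modulus at most 1. It shows that the set in the definition of \<open>spectral_norm\<close> is
  bounded above, so that its supremum really is an upper bound.\<close>

lemma vec_l2norm_mult_le:
  assumes X: "X \<in> carrier_mat m n" and v: "v \<in> carrier_vec n" "vec_l2norm v \<le> 1"
  shows "vec_l2norm (X *\<^sub>v v) \<le> sqrt (\<Sum>i<m. (\<Sum>j<n. cmod (X $$ (i, j)))\<^sup>2)"
proof -
  have v1: "cmod (v $ j) \<le> 1" if "j < n" for j
  proof -
    have "(cmod (v $ j))\<^sup>2 \<le> (\<Sum>i<n. (cmod (v $ i))\<^sup>2)"
      using that by (intro member_le_sum) auto
    also have "\<dots> \<le> 1" using v by (simp add: vec_l2norm_eq)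
    finally show ?thesis by (simp add: abs_square_le_1)
  qed
  have "cmod ((X *\<^sub>v v) $ i) \<le> (\<Sum>j<n. cmod (X $$ (i, j)))" if "i < m" for i
  proof -
    have "(X *\<^sub>v v) $ i = (\<Sum>j<n. X $$ (i, j) * v $ j)"
      using that X v by (auto simp: scalar_prod_def lessThan_atLeast0)
    also have "cmod \<dots> \<le> (\<Sum>j<n. cmod (X $$ (i, j) * v $ j))" by (rule norm_sum)
    also have "\<dots> \<le> (\<Sum>j<n. cmod (X $$ (i, j)))"
      using v1 by (intro sum_mono) (auto simp: norm_mult intro: mult_left_le)
    finally show ?thesis .
  qed
  thus ?thesis using X unfolding vec_l2norm_eq
    by (intro real_sqrt_le_mono) (auto intro!: sum_mono power_mono simp del: index_mult_mat_vec)
qed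

lemma vec_l2norm_le_spectral_norm:
  assumes X: "X \<in> carrier_mat m n" and v: "v \<in> carrier_vec n" "vec_l2norm v \<le> 1"
  shows "vec_l2norm (X *\<^sub>v v) \<le> spectral_norm X"
  unfolding spectral_norm_def
proof (rule cSUP_upper)
  show "bdd_above ((\<lambda>v. vec_l2norm (X *\<^sub>v v)) ` {v \<in> carrier_vec (dim_col X). vec_l2norm v \<le> 1})"
    using vec_l2norm_mult_le[OF X] X by (intro bdd_aboveI2) auto
qed (use X v in auto)

text \<open>A unit eigenvector competes in the supremum, and its image has norm equal to the modulus
  of the eigenvalue.\<close>

lemma abs_eigenvalue_le_spectral_norm:
  assumes X: "X \<in> carrier_mat n n" and "spectral_decomp X U d" "i < n"
  shows "\<bar>d i\<bar> \<le> spectral_norm X"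
proof -
  note e = spectral_decomp_eigenvector[OF X assms(2,3)]
  have "vec_l2norm (X *\<^sub>v col U i) \<le> spectral_norm X"
    using e by (intro vec_l2norm_le_spectral_norm[OF X]) (auto simp: vec_l2norm_def)
  moreover have "(X *\<^sub>v col U i) \<bullet>c (X *\<^sub>v col U i) = complex_of_real ((d i)\<^sup>2)"
    unfolding e(3) using e(1,2) by (simp add: conjugate_smult_vec power2_eq_square)
  ultimately show ?thesis by (simp add: vec_l2norm_def)
qed

section \<open>Ordered eigenvalues and the dimension count\<close>

lemma eigval_desc_eq:
  assumes X: "X \<in> carrier_mat n n" and dec: "spectral_decomp X U d"
  shows "eigval_desc X k = rev (sort (map d [0..<n])) ! (k - 1)"
proof -
  note U = spectral_decompD[OF X dec]
  let ?D = "real_diag n d"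
  have D: "?D \<in> carrier_mat n n" by simp
  \<comment> \<open>Similar matrices share their characteristic polynomial, and that of the diagonal
    matrix has the entries of \<open>d\<close> as roots, with multiplicity.\<close>
  have "similar_mat X ?D"
    using U(1,3) X unitary_carrierD[OF U(2,1)] mat_adjoint_carrier[OF U(1)]
    by (intro similar_matI[of _ _ U "mat_adjoint U" n]) auto
  hence "char_poly X = char_poly ?D" by (rule char_poly_similar)
  also have "\<dots> = (\<Prod>a\<leftarrow>diag_mat ?D. [:- a, 1:])"
    by (rule char_poly_upper_triangular[OF D]) (auto simp: mat_diag_def)
  also have "diag_mat ?D = map (\<lambda>i. complex_of_real (d i)) [0..<n]"
    by (auto simp: diag_mat_def mat_diag_def)
  finally have cp: "char_poly X = (\<Prod>a\<leftarrow>map (\<lambda>i. complex_of_real (d i)) [0..<n]. [:- a, 1:])" .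
  have pr: "proots (\<Prod>a\<leftarrow>as. [:- a, 1:]) = mset as" for as :: "complex list"
  proof (induction as)
    case (Cons a as)
    have "(\<Prod>a\<leftarrow>as. [:- a, 1:]) \<noteq> 0" by (auto simp: prod_list_zero_iff)
    thus ?case using Cons by (simp add: proots_mult del: mult_pCons_left)
  qed auto
  hence "image_mset Re (proots (char_poly X)) = mset (map d [0..<n])"
    unfolding cp pr by (simp add: image_mset.compositionality o_def)
  thus ?thesis unfolding eigval_desc_def by (simp only: sorted_list_of_multiset_mset)
qed

text \<open>In a non-increasing list, entries strictly below the one at position
  \<open>k - 1\<close> come after it, and entries strictly above come before it. Strict comparison
  makes the bounds valid in the presence of repeated eigenvalues.\<close>

lemma eigval_desc_card:
  assumes X: "X \<in> carrier_mat n n" and dec: "spectral_decomp X U d" and k: "k \<in> {1..n}"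
  shows "card {i. i < n \<and> d i < eigval_desc X k} \<le> n - k"
    "card {i. i < n \<and> eigval_desc X k < d i} \<le> k - 1"
proof -
  define ys where "ys = rev (sort (map d [0..<n]))"
  have len: "length ys = n" by (simp add: ys_def)
  have ev: "eigval_desc X k = ys ! (k - 1)" unfolding ys_def by (rule eigval_desc_eq[OF X dec])
  have mono: "ys ! j \<le> ys ! i" if "i \<le> j" "j < n" for i j
    using that len unfolding ys_def by (intro sorted_rev_nth_mono) auto
  have k1: "k - 1 < n" using k by auto
  \<comment> \<open>Counting depends only on the multiset of values, so \<open>d\<close> may be
    replaced by its sorted rearrangement \<open>ys\<close>.\<close>
  have count: "card {i. i < n \<and> P (d i)} = card {i. i < n \<and> P (ys ! i)}" for P
  proof -
    have "length (filter P (map d [0..<n])) = length (filter P ys)"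
      by (metis mset_filter mset_rev mset_sort size_mset ys_def)
    thus ?thesis by (simp add: length_filter_conv_card len cong: conj_cong)
  qed
  have "{i. i < n \<and> ys ! i < ys ! (k - 1)} \<subseteq> {k..<n}"
  proof
    fix i assume i: "i \<in> {i. i < n \<and> ys ! i < ys ! (k - 1)}"
    hence "\<not> i \<le> k - 1" using mono[of i "k - 1"] k1 by auto
    thus "i \<in> {k..<n}" using i k by auto
  qed
  hence "card {i. i < n \<and> ys ! i < ys ! (k - 1)} \<le> card {k..<n}" by (intro card_mono) auto
  thus "card {i. i < n \<and> d i < eigval_desc X k} \<le> n - k" unfolding ev count[of "\<lambda>r. r < ys ! (k - 1)"] by simp
  have "{i. i < n \<and> ys ! (k - 1) < ys ! i} \<subseteq> {..<k - 1}"
    using mono[of "k - 1"] by (force simp: not_le[symmetric])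
  hence "card {i. i < n \<and> ys ! (k - 1) < ys ! i} \<le> card {..<k - 1}" by (intro card_mono) auto
  thus "card {i. i < n \<and> eigval_desc X k < d i} \<le> k - 1" unfolding ev count[of "\<lambda>r. ys ! (k - 1) < r"] by simp
qed

text \<open>
  Dimension count behind the Courant--Fischer principle: the span of the eigenvectors of \<open>X\<close> for
  its \<open>k\<close> largest eigenvalues meets that of \<open>Y\<close> for its \<open>n - k + 1\<close> smallest ones.
\<close>

lemma exists_vec_top_bottom_eigenspaces:
  assumes X: "X \<in> carrier_mat n n" "spectral_decomp X U d"
    and Y: "Y \<in> carrier_mat n n" "spectral_decomp Y V e" and k: "k \<in> {1..n}"
  shows "\<exists>x. x \<in> carrier_vec n \<and> x \<bullet>c x = 1 \<and>
    (\<forall>i<n. d i < eigval_desc X k \<longrightarrow> spectral_weight U x i = 0) \<and>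
    (\<forall>i<n. eigval_desc Y k < e i \<longrightarrow> spectral_weight V x i = 0)"
proof -
  define I where "I = filter (\<lambda>i. d i < eigval_desc X k) [0..<n]"
  define J where "J = filter (\<lambda>i. eigval_desc Y k < e i) [0..<n]"
  \<comment> \<open>Membership in each span is expressed as orthogonality to the remaining
    eigenvectors. These are at most \<open>(n - k) + (k - 1) = n - 1\<close> conditions, which
    leaves room for a unit vector.\<close>
  have "length I \<le> n - k" "length J \<le> k - 1"
    using eigval_desc_card(1)[OF X k] eigval_desc_card(2)[OF Y k]
    by (simp_all add: I_def J_def length_filter_conv_card cong: conj_cong)
  hence "length (map (col U) I @ map (col V) J) < n" using k by auto
  moreover have "set (map (col U) I @ map (col V) J) \<subseteq> carrier_vec n"
    using spectral_decompD(1)[OF X] spectral_decompD(1)[OF Y] by (auto simp: I_def J_def)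
  ultimately obtain x where "x \<in> carrier_vec n" "x \<bullet>c x = 1"
    "\<forall>v \<in> set (map (col U) I @ map (col V) J). x \<bullet>c v = 0"
    using exists_unit_orthogonal_vec by blast
  thus ?thesis by (intro exI[of _ x]) (auto simp: spectral_weight_def I_def J_def)
qed

subsection \<open>Concave functions\<close>

text \<open>\<open>t\<close> is the convex combination of \<open>0\<close> and \<open>s\<close> with
  weight \<open>t / s\<close> on \<open>s\<close>. In effect, slopes of chords starting at
  \<open>0\<close> decrease with the right endpoint.\<close>

lemma concave_on_chord_from_zero:
  fixes g :: "real \<Rightarrow> real"
  assumes "concave_on {0..} g" "0 \<le> t" "t \<le> s" "0 < s"
  shows "t / s * (g s - g 0) \<le> g t - g 0"
proof -
  have "(1 - t / s) * g 0 + t / s * g s \<le> g ((1 - t / s) *\<^sub>R 0 + (t / s) *\<^sub>R s)"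
    using assms by (intro concave_onD[OF assms(1)]) auto
  thus ?thesis using assms(4) by (simp add: algebra_simps)
qed

text \<open>Two slope comparisons through \<open>s = t + \<beta>\<close>: the slope over
  \<open>[t, s]\<close> is at most that over \<open>[0, s]\<close>, which is at most that over
  \<open>[0, b]\<close> because \<open>b \<le> s\<close>.\<close>

lemma concave_on_increment_le:
  fixes g :: "real \<Rightarrow> real"
  assumes g: "concave_on {0..} g" and "0 \<le> t" "0 \<le> \<beta>" "0 < b" "b \<le> t + \<beta>"
  shows "g (t + \<beta>) - g t \<le> \<beta> / b * (g b - g 0)"
proof -
  define s where "s = t + \<beta>"
  have s: "0 < s" using assms by (simp add: s_def)
  have "t / s * (g s - g 0) \<le> g t - g 0"
    using assms s by (intro concave_on_chord_from_zero[OF g]) (auto simp: s_def)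
  moreover have "t / s = 1 - \<beta> / s" using s by (simp add: s_def field_simps)
  ultimately have "g s - g t \<le> \<beta> / s * (g s - g 0)" by (simp add: algebra_simps)
  also have "\<dots> = \<beta> / b * (b / s * (g s - g 0))" using assms by simp
  also have "\<dots> \<le> \<beta> / b * (g b - g 0)"
    using assms s by (intro mult_left_mono concave_on_chord_from_zero[OF g]) (auto simp: s_def)
  finally show ?thesis by (simp add: s_def)
qed

text \<open>The scalar core of the theorem: \<open>a\<close>, \<open>c\<close> stand for the
  eigenvalues of \<open>A\<close>, \<open>B\<close> and \<open>w\<close>, \<open>v\<close> for the
  spectral weights of one unit vector. Jensen bounds the first sum from above, the chord of
  \<open>g\<close> over \<open>[0, b]\<close> bounds the second from below, and the slope comparison
  combines them.\<close>

lemma concave_on_weighted_difference_le: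
  fixes g :: "real \<Rightarrow> real" and a c v w :: "nat \<Rightarrow> real"
  assumes g: "concave_on {0..} g" and mono: "mono_on {0..} g"
    and w: "\<And>i. 0 \<le> w i" "(\<Sum>i<n. w i) = 1" and v: "\<And>i. 0 \<le> v i" "(\<Sum>i<n. v i) = 1"
    and a: "\<And>i. i < n \<Longrightarrow> 0 \<le> a i" and c: "\<And>i. i < n \<Longrightarrow> 0 \<le> c i" "\<And>i. i < n \<Longrightarrow> c i \<le> b"
    and b: "0 \<le> b" "b \<le> (\<Sum>i<n. a i * w i)" and t: "0 \<le> t"
    and le: "(\<Sum>i<n. a i * w i) - (\<Sum>i<n. c i * v i) \<le> t"
  shows "(\<Sum>i<n. g (a i) * w i) - (\<Sum>i<n. g (c i) * v i) \<le> g t - g 0"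
proof -
  define \<alpha> \<beta> where "\<alpha> = (\<Sum>i<n. a i * w i)" and "\<beta> = (\<Sum>i<n. c i * v i)"
  have n: "n \<noteq> 0" using w(2) by (intro notI) simp
  have \<beta>0: "0 \<le> \<beta>" unfolding \<beta>_def using c v by (intro sum_nonneg mult_nonneg_nonneg) auto
  have "(\<Sum>i<n. w i * g (a i)) \<le> g (\<Sum>i<n. w i *\<^sub>R a i)"
    using g w a n by (intro concave_on_sum) auto
  hence "(\<Sum>i<n. g (a i) * w i) \<le> g \<alpha>" by (simp add: \<alpha>_def mult.commute)
  also have "\<dots> \<le> g (t + \<beta>)"
    using le b \<beta>0 t by (intro mono_onD[OF mono]) (auto simp: \<alpha>_def \<beta>_def)
  finally have A: "(\<Sum>i<n. g (a i) * w i) \<le> g (t + \<beta>)" .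
  show ?thesis
  proof (cases "b = 0")
    \<comment> \<open>The chord degenerates here. All \<open>c i\<close> are zero, so the second sum
      is \<open>g 0\<close> and Jensen alone suffices.\<close>
    case True
    hence c0: "c i = 0" if "i < n" for i using c[OF that] by simp
    hence "\<beta> = 0" by (simp add: \<beta>_def)
    moreover have "(\<Sum>i<n. g (c i) * v i) = g 0" using c0 v(2) by (simp flip: sum_distrib_left)
    ultimately show ?thesis using A by simp
  next
    case False
    hence b': "0 < b" using b by simp
    \<comment> \<open>The chord is affine, so its mean under the weights \<open>v\<close> is its
      value at the mean \<beta>.\<close>
    have "g 0 + \<beta> / b * (g b - g 0) = (\<Sum>i<n. (g 0 + c i / b * (g b - g 0)) * v i)"
      using v(2)
      by (simp add: \<beta>_def distrib_right sum.distrib sum_divide_distrib sum_distrib_left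
          sum_distrib_right flip: sum_distrib_left[of "g 0"])
        (simp add: ac_simps)
    also have "\<dots> \<le> (\<Sum>i<n. g (c i) * v i)"
    proof (intro sum_mono mult_right_mono)
      fix i assume "i \<in> {..<n}"
      hence "c i / b * (g b - g 0) \<le> g (c i) - g 0"
        using c b' by (intro concave_on_chord_from_zero[OF g]) auto
      thus "g 0 + c i / b * (g b - g 0) \<le> g (c i)" by simp
    qed (use v in auto)
    finally show ?thesis
      using A concave_on_increment_le[OF g t \<beta>0 b'] le b by (simp add: \<alpha>_def \<beta>_def)
  qed
qed

section \<open>Comparing the eigenvalues of \<open>g(A - B)\<close> and
  \<open>g(A) - g(B)\<close>\<close>

theorem theorem1:
  fixes g :: "real \<Rightarrow> real" and n :: nat and A B :: "complex mat"
  assumes "\<And>x. 0 \<le> x \<Longrightarrow> 0 \<le> g x"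
    and "mono_on {0..} g"
    and "concave_on {0..} g"
    and "A \<in> carrier_mat n n" and "B \<in> carrier_mat n n"
    and "pos_semidef A" and "pos_semidef B"
    and "loewner_le (complex_of_real (spectral_norm B) \<cdot>\<^sub>m 1\<^sub>m n) A"
  shows "\<forall>k \<in> {1..n}.
    eigval_desc (mat_fun g (A - B)) k \<ge> eigval_desc (mat_fun g A - mat_fun g B) k"
proof
  fix k assume k: "k \<in> {1..n}"
  note g0 = assms(1) and mono = assms(2) and conc = assms(3)
  note A = assms(4) and B = assms(5) and psd = assms(6,7)
  have D: "A - B \<in> carrier_mat n n" using B by (rule minus_carrier_mat)
  have hA: "hermitian A" and hB: "hermitian B" using psd by (auto simp: pos_semidef_def)
  obtain U a where Ua: "spectral_decomp A U a" using hermitian_spectral_decomp[OF A hA] by blast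
  obtain V c where Vc: "spectral_decomp B V c" using hermitian_spectral_decomp[OF B hB] by blast
  obtain W d where Wd: "spectral_decomp (A - B) W d"
    using hermitian_spectral_decomp[OF D] hermitian_minus[OF hA hB A B] by blast
  note U = spectral_decompD[OF A Ua] and V = spectral_decompD[OF B Vc] and W = spectral_decompD[OF D Wd]
  define gA where "gA = mat_fun g A"
  define gB where "gB = mat_fun g B"
  define gD where "gD = mat_fun g (A - B)"
  have gA: "gA = U * real_diag n (g \<circ> a) * mat_adjoint U"
    using mat_fun_eq[OF Ua] A by (simp add: gA_def)
  have gB: "gB = V * real_diag n (g \<circ> c) * mat_adjoint V"
    using mat_fun_eq[OF Vc] B by (simp add: gB_def)
  have gD: "gD = W * real_diag n (g \<circ> d) * mat_adjoint W"
    using mat_fun_eq[OF Wd] B by (simp add: gD_def)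
  have gAc: "gA \<in> carrier_mat n n" and gBc: "gB \<in> carrier_mat n n" and gDc: "gD \<in> carrier_mat n n"
    using U(1) V(1) W(1) by (auto simp: gA gB gD)
  have C: "gA - gB \<in> carrier_mat n n" using gBc by (rule minus_carrier_mat)
  obtain P p where Pp: "spectral_decomp (gA - gB) P p"
    using hermitian_spectral_decomp[OF C] hermitian_minus[OF _ _ gAc gBc]
      hermitian_unitary_conj_real_diag U(1) V(1) unfolding gA gB by blast
  \<comment> \<open>Diagonalising \<open>g(A - B)\<close> by the eigenvectors \<open>W\<close> of
    \<open>A - B\<close> lets a condition on the values \<open>g (d i)\<close> be read as one on the
    weights of \<open>x\<close> for \<open>A - B\<close> itself.\<close>
  have gDd: "spectral_decomp gD W (g \<circ> d)"
    unfolding gD by (rule spectral_decompI[OF W(1,2)])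
  obtain x where x: "x \<in> carrier_vec n" "x \<bullet>c x = 1"
    and xP: "\<And>i. i < n \<Longrightarrow> p i < eigval_desc (gA - gB) k \<Longrightarrow> spectral_weight P x i = 0"
    and xW: "\<And>i. i < n \<Longrightarrow> eigval_desc gD k < g (d i) \<Longrightarrow> spectral_weight W x i = 0"
    using exists_vec_top_bottom_eigenspaces[OF C Pp gDc gDd k] by auto
  have w0: "0 \<le> spectral_weight Q x i" for Q i by (simp add: spectral_weight_def)
  have w1: "(\<Sum>i<n. spectral_weight Q x i) = 1" if "Q \<in> carrier_mat n n" "unitary Q" for Q
    using sum_spectral_weight[OF that(2,1) x(1)] x(2) by (metis of_real_eq_1_iff)
  have diff: "((X - Y) *\<^sub>v x) \<bullet>c x = (X *\<^sub>v x) \<bullet>c x - (Y *\<^sub>v x) \<bullet>c x"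
    if "X \<in> carrier_mat n n" "Y \<in> carrier_mat n n" for X Y
    using that x(1) by (simp add: minus_mult_distrib_mat_vec[of _ n n] minus_scalar_prod_distrib[of _ n])

  define \<alpha> where "\<alpha> = (\<Sum>i<n. a i * spectral_weight U x i)"
  define \<beta> where "\<beta> = (\<Sum>i<n. c i * spectral_weight V x i)"
  have qA: "(A *\<^sub>v x) \<bullet>c x = complex_of_real \<alpha>"
    unfolding \<alpha>_def by (rule cscalar_prod_spectral_decomp[OF A Ua x(1)])
  have qB: "(B *\<^sub>v x) \<bullet>c x = complex_of_real \<beta>"
    unfolding \<beta>_def by (rule cscalar_prod_spectral_decomp[OF B Vc x(1)])
  have qD: "\<alpha> - \<beta> = (\<Sum>i<n. d i * spectral_weight W x i)"
    using cscalar_prod_spectral_decomp[OF D Wd x(1)] unfolding diff[OF A B] qA qB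
    by (metis of_real_diff of_real_eq_iff)
  have qC: "(\<Sum>i<n. p i * spectral_weight P x i) =
      (\<Sum>i<n. g (a i) * spectral_weight U x i) - (\<Sum>i<n. g (c i) * spectral_weight V x i)"
  proof -
    have "complex_of_real (\<Sum>i<n. p i * spectral_weight P x i) = (gA *\<^sub>v x) \<bullet>c x - (gB *\<^sub>v x) \<bullet>c x"
      using cscalar_prod_spectral_decomp[OF C Pp x(1)] diff[OF gAc gBc] by simp
    also have "(gA *\<^sub>v x) \<bullet>c x = complex_of_real (\<Sum>i<n. g (a i) * spectral_weight U x i)"
      unfolding gA spectral_quadratic_form[OF U(1) x(1)] by simp
    also have "(gB *\<^sub>v x) \<bullet>c x = complex_of_real (\<Sum>i<n. g (c i) * spectral_weight V x i)"
      unfolding gB spectral_quadratic_form[OF V(1) x(1)] by simp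
    finally show ?thesis by (metis of_real_diff of_real_eq_iff)
  qed

  define b where "b = spectral_norm B"
  have c: "0 \<le> c i" "c i \<le> b" if "i < n" for i
    using pos_semidef_eigenvalue_nonneg[OF B Vc psd(2) that] abs_eigenvalue_le_spectral_norm[OF B Vc that]
    by (auto simp: b_def)
  \<comment> \<open>Index 0 is legitimate since \<open>k \<in> {1..n}\<close> forces
    \<open>n > 0\<close>.\<close>
  have b: "0 \<le> b" using c[of 0] k by simp
  \<comment> \<open>The operator inequality is evaluated at the unit vector
    \<open>x\<close>.\<close>
  have "b \<le> \<alpha>"
  proof -
    let ?I = "complex_of_real b \<cdot>\<^sub>m 1\<^sub>m n"
    have "?I = real_diag n (\<lambda>_. b)" by (intro eq_matI) (auto simp: mat_diag_def)
    hence "?I *\<^sub>v x = complex_of_real b \<cdot>\<^sub>v x"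
      using x(1) real_diag_mult_vec_index[OF x(1), of _ "\<lambda>_. b"] by (intro eq_vecI) (auto simp: mat_diag_def)
    hence "((A - ?I) *\<^sub>v x) \<bullet>c x = complex_of_real (\<alpha> - b)"
      using diff[OF A, of ?I] qA x by simp
    moreover have "0 \<le> Re (((A - ?I) *\<^sub>v x) \<bullet>c x)"
      using assms(8) x(1) A by (auto simp: loewner_le_def pos_semidef_def b_def)
    ultimately show ?thesis by simp
  qed
  have "\<beta> \<le> (\<Sum>i<n. b * spectral_weight V x i)"
    unfolding \<beta>_def using c w0 by (intro sum_mono mult_right_mono) auto
  hence "\<beta> \<le> b" using w1[OF V(1,2)] by (simp flip: sum_distrib_left)

  define J where "J = {i. i < n \<and> g (d i) \<le> eigval_desc gD k}"
  have "J \<noteq> {}"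
  proof
    assume "J = {}"
    hence "spectral_weight W x i = 0" if "i < n" for i using xW[OF that] that by (auto simp: J_def not_le)
    thus False using w1[OF W(1,2)] by simp
  qed
  have finJ: "finite J" by (simp add: J_def)
  \<comment> \<open>Every eigenvalue of \<open>A - B\<close> that carries weight has its index in
    \<open>J\<close>, so \<open>t\<close> bounds \<alpha> - \<beta>. As the maximum is attained on
    \<open>J\<close>, \<open>g t\<close> satisfies the inequality defining \<open>J\<close>.\<close>
  define t where "t = Max (d ` J)"
  have "\<alpha> - \<beta> \<le> (\<Sum>i<n. t * spectral_weight W x i)"
    unfolding qD
  proof (intro sum_mono)
    fix i assume i: "i \<in> {..<n}"
    show "d i * spectral_weight W x i \<le> t * spectral_weight W x i"
    proof (cases "i \<in> J")
      case True
      hence "d i \<le> t" unfolding t_def using finJ by (intro Max_ge) auto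
      thus ?thesis using w0 by (intro mult_right_mono)
    next
      case False
      thus ?thesis using xW[of i] i by (simp add: J_def)
    qed
  qed
  hence \<alpha>\<beta>: "\<alpha> - \<beta> \<le> t" using w1[OF W(1,2)] by (simp flip: sum_distrib_left)
  hence t: "0 \<le> t" using \<open>b \<le> \<alpha>\<close> \<open>\<beta> \<le> b\<close> by simp
  have "t \<in> d ` J" unfolding t_def using finJ \<open>J \<noteq> {}\<close> by (intro Max_in) auto
  hence gt: "g t \<le> eigval_desc gD k" by (auto simp: J_def)

  \<comment> \<open>The weights sum to one and vanish wherever \<open>p i\<close> is below the
    \<open>k\<close>-th eigenvalue, so the quadratic form at \<open>x\<close> is at least that
    eigenvalue.\<close>
  have "eigval_desc (gA - gB) k = (\<Sum>i<n. eigval_desc (gA - gB) k * spectral_weight P x i)"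
    using w1[OF spectral_decompD(1,2)[OF C Pp]] by (simp flip: sum_distrib_left)
  also have "\<dots> \<le> (\<Sum>i<n. p i * spectral_weight P x i)"
  proof (intro sum_mono)
    fix i assume i: "i \<in> {..<n}"
    show "eigval_desc (gA - gB) k * spectral_weight P x i \<le> p i * spectral_weight P x i"
    proof (cases "p i < eigval_desc (gA - gB) k")
      case True
      thus ?thesis using xP i by simp
    next
      case False
      thus ?thesis using w0 by (intro mult_right_mono) auto
    qed
  qed
  also have "\<dots> \<le> g t - g 0"
    unfolding qC
  proof (rule concave_on_weighted_difference_le[OF conc mono, where b = b])
    show "0 \<le> a i" if "i < n" for i using pos_semidef_eigenvalue_nonneg[OF A Ua psd(1) that] .
  qed (use w0 w1[OF U(1,2)] w1[OF V(1,2)] c b t \<alpha>\<beta> \<open>b \<le> \<alpha>\<close> in \<open>auto simp: \<alpha>_def \<beta>_def\<close>)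
  \<comment> \<open>Nonnegativity of \<open>g\<close> at \<open>0\<close> allows the term
    \<open>g 0\<close> to be dropped.\<close>
  also have "\<dots> \<le> g t" using g0[of 0] by simp
  also note gt
  finally show "eigval_desc (mat_fun g A - mat_fun g B) k \<le> eigval_desc (mat_fun g (A - B)) k"
    unfolding gA_def gB_def gD_def .
qed
end
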